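(* Let $G$ be a groupoid with $|\mathrm{ob}(G)|<\infty$ and let $A\rtimes^{\sigma}G$ be the skew groupoid algebra associated to a skew system $\{A,G,\sigma\}$ such that all rings $A_e$, for $e\in\mathrm{ob}(G)$, are commutative. Then $A$ is maximal commutative in $A\rtimes^{\sigma}G$ if and only if for every nonzero twosided ideal $I$ of $A\rtimes^{\sigma}G$ the intersection $I\cap A$ is nonzero.
   Context: All rings are associative and unital, with nonzero identity; ring homomorphisms respect identities. A commutative subring $R_1$ of a ring $R$ is called maximal commutative in $R$ if it coincides with its commutant $C_R(R_1)=\{r\in R: rx=xr \text{ for all } x\in R_1\}$. For a category $G$, an object is identified with its identity morphism, $s\in G$ means that $s$ is a morphism, $d(s)$ and $c(s)$ are the domain and codomain of $s$, and $G^{(2)}$ is the set of pairs $(s,t)$ of morphisms with $d(s)=c(t)$ (with composite $st$). A groupoid is a category in which all morphisms are invertible. A skew system is a triple $\{A,G,\sigma\}$ where $G$ is a small category, $A$ is the direct sum of rings $A_e$, $e\in\mathrm{ob}(G)$, and $\sigma_s:A_{d(s)}\to A_{c(s)}$, $s\in G$, are ring homomorphisms such that $\sigma_e=\mathrm{id}_{A_e}$ for all $e\in\mathrm{ob}(G)$ and $\sigma_s(\sigma_t(a))=\sigma_{st}(a)$ for all $(s,t)\in G^{(2)}$ and $a\in A_{d(t)}$. The skew category algebra $A\rtimes^{\sigma}G$ is the set of formal sums $\sum_{s\in G}a_su_s$ with $a_s\in A_{c(s)}$, all but finitely many zero, with pointwise addition and with multiplication the bilinear extension of $(a_su_s)(b_tu_t)=a_s\sigma_s(b_t)u_{st}$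 if $(s,t)\in G^{(2)}$ and $(a_su_s)(b_tu_t)=0$ otherwise, where $a_s\in A_{c(s)}$, $b_t\in A_{c(t)}$. When $\mathrm{ob}(G)$ is finite it is a ring with identity $\sum_{e\in\mathrm{ob}(G)}u_e$. If $G$ is a groupoid it is called a skew groupoid algebra. The ring $A$ is identified with the subring $\bigoplus_{e\in\mathrm{ob}(G)}A_eu_e$ of $A\rtimes^{\sigma}G$. *)

theory Defs
  imports "HOL-Algebra.Algebra"
begin

text \<open>
  Categories are given by their morphisms alone. An object is identified with its identity
  morphism, so domain and codomain are again morphisms. Every small category has this form.
\<close>

record 'm cat =
  Mor :: "'m set"
  Dom :: "'m \<Rightarrow> 'm"
  Cod :: "'m \<Rightarrow> 'm"
  Cmp :: "'m \<Rightarrow> 'm \<Rightarrow> 'm"  (infixl "\<diamondop>\<index>" 70)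

text \<open>The product \<open>s \<diamondop> t\<close> is meaningful only if \<open>Dom G s = Cod G t\<close> (first \<open>t\<close>, then \<open>s\<close>).\<close>

locale small_category =
  fixes G :: "'m cat" (structure)
  assumes Dom_closed: "s \<in> Mor G \<Longrightarrow> Dom G s \<in> Mor G"
    and Cod_closed: "s \<in> Mor G \<Longrightarrow> Cod G s \<in> Mor G"
    and Dom_Dom: "s \<in> Mor G \<Longrightarrow> Dom G (Dom G s) = Dom G s"
    and Cod_Dom: "s \<in> Mor G \<Longrightarrow> Cod G (Dom G s) = Dom G s"
    and Dom_Cod: "s \<in> Mor G \<Longrightarrow> Dom G (Cod G s) = Cod G s"
    and Cod_Cod: "s \<in> Mor G \<Longrightarrow> Cod G (Cod G s) = Cod G s"
    and Cmp_closed: "\<lbrakk>s \<in> Mor G; t \<in> Mor G; Dom G s = Cod G t\<rbrakk> \<Longrightarrow> s \<diamondop> t \<in> Mor G"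
    and Dom_Cmp: "\<lbrakk>s \<in> Mor G; t \<in> Mor G; Dom G s = Cod G t\<rbrakk> \<Longrightarrow> Dom G (s \<diamondop> t) = Dom G t"
    and Cod_Cmp: "\<lbrakk>s \<in> Mor G; t \<in> Mor G; Dom G s = Cod G t\<rbrakk> \<Longrightarrow> Cod G (s \<diamondop> t) = Cod G s"
    and Cmp_assoc: "\<lbrakk>r \<in> Mor G; s \<in> Mor G; t \<in> Mor G; Dom G r = Cod G s; Dom G s = Cod G t\<rbrakk>
      \<Longrightarrow> (r \<diamondop> s) \<diamondop> t = r \<diamondop> (s \<diamondop> t)"
    and Cmp_Dom: "s \<in> Mor G \<Longrightarrow> s \<diamondop> Dom G s = s"
    and Cod_Cmp_id: "s \<in> Mor G \<Longrightarrow> Cod G s \<diamondop> s = s"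

definition Ob :: "'m cat \<Rightarrow> 'm set" where
  "Ob G = {e \<in> Mor G. Dom G e = e}"

definition composable :: "'m cat \<Rightarrow> ('m \<times> 'm) set" where
  "composable G = {(s, t). s \<in> Mor G \<and> t \<in> Mor G \<and> Dom G s = Cod G t}"

locale groupoid = small_category +
  assumes invertible: "s \<in> Mor G \<Longrightarrow>
    \<exists>t \<in> Mor G. Dom G t = Cod G s \<and> Cod G t = Dom G s \<and> s \<diamondop> t = Cod G s \<and> t \<diamondop> s = Dom G s"

text \<open>
  The rings \<open>A e\<close> share an element type, but their carriers and operations are unrelated.
\<close>

locale skew_system = small_category G
  for G :: "'m cat" (structure)
    and A :: "'m \<Rightarrow> ('a, 'b) ring_scheme"
    and \<sigma> :: "'m \<Rightarrow> 'a \<Rightarrow> 'a" +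
  assumes ring_A: "e \<in> Ob G \<Longrightarrow> ring (A e)"
    and one_neq_zero: "e \<in> Ob G \<Longrightarrow> \<one>\<^bsub>A e\<^esub> \<noteq> \<zero>\<^bsub>A e\<^esub>"
    and sigma_hom: "s \<in> Mor G \<Longrightarrow> \<sigma> s \<in> ring_hom (A (Dom G s)) (A (Cod G s))"
    and sigma_id: "\<lbrakk>e \<in> Ob G; a \<in> carrier (A e)\<rbrakk> \<Longrightarrow> \<sigma> e a = a"
    and sigma_Cmp: "\<lbrakk>(s, t) \<in> composable G; a \<in> carrier (A (Dom G t))\<rbrakk>
      \<Longrightarrow> \<sigma> s (\<sigma> t a) = \<sigma> (s \<diamondop> t) a"

definition skew_support :: "'m cat \<Rightarrow> ('m \<Rightarrow> ('a, 'b) ring_scheme) \<Rightarrow> ('m \<Rightarrow> 'a) \<Rightarrow> 'm set" where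
  "skew_support G A x = {s \<in> Mor G. x s \<noteq> \<zero>\<^bsub>A (Cod G s)\<^esub>}"

text \<open>
  A formal sum of terms \<open>a\<^sub>s u\<^sub>s\<close> is the function \<open>s \<mapsto> a\<^sub>s\<close>, set to \<open>undefined\<close>
  outside \<open>Mor G\<close>. In a product, the coefficient at \<open>r\<close> collects \<open>a\<^sub>s \<sigma>\<^sub>s(b\<^sub>t)\<close> over the
  composable pairs with \<open>s \<diamondop> t = r\<close>; restricting to the supports makes this sum finite.
  The field \<open>one\<close> is an element of the carrier only if \<open>Ob G\<close> is finite.
\<close>

definition skew_algebra ::
  "'m cat \<Rightarrow> ('m \<Rightarrow> ('a, 'b) ring_scheme) \<Rightarrow> ('m \<Rightarrow> 'a \<Rightarrow> 'a) \<Rightarrow> ('m \<Rightarrow> 'a) ring" where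
  "skew_algebra G A \<sigma> =
    \<lparr>carrier = {x \<in> (\<Pi>\<^sub>E s \<in> Mor G. carrier (A (Cod G s))). finite (skew_support G A x)},
     monoid.mult = (\<lambda>x y. \<lambda>r \<in> Mor G.
       finsum (A (Cod G r))
         (\<lambda>(s, t). x s \<otimes>\<^bsub>A (Cod G s)\<^esub> \<sigma> s (y t))
         {(s, t). (s, t) \<in> composable G \<and>
           s \<in> skew_support G A x \<and> t \<in> skew_support G A y \<and> s \<diamondop>\<^bsub>G\<^esub> t = r}),
     one = (\<lambda>s \<in> Mor G. if s \<in> Ob G then \<one>\<^bsub>A s\<^esub> else \<zero>\<^bsub>A (Cod G s)\<^esub>),
     ring.zero = (\<lambda>s \<in> Mor G. \<zero>\<^bsub>A (Cod G s)\<^esub>),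
     add = (\<lambda>x y. \<lambda>s \<in> Mor G. x s \<oplus>\<^bsub>A (Cod G s)\<^esub> y s)\<rparr>"

text \<open>The direct sum of the rings \<open>A e\<close>, as the subring of the sums of terms \<open>a\<^sub>e u\<^sub>e\<close>.\<close>

definition base_ring ::
  "'m cat \<Rightarrow> ('m \<Rightarrow> ('a, 'b) ring_scheme) \<Rightarrow> ('m \<Rightarrow> 'a \<Rightarrow> 'a) \<Rightarrow> ('m \<Rightarrow> 'a) set" where
  "base_ring G A \<sigma> = {x \<in> carrier (skew_algebra G A \<sigma>). skew_support G A x \<subseteq> Ob G}"

definition commutant :: "('a, 'b) ring_scheme \<Rightarrow> 'a set \<Rightarrow> 'a set" where
  "commutant R S = {r \<in> carrier R. \<forall>x \<in> S. r \<otimes>\<^bsub>R\<^esub> x = x \<otimes>\<^bsub>R\<^esub> r}"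

definition maximal_commutative :: "'a set \<Rightarrow> ('a, 'b) ring_scheme \<Rightarrow> bool" where
  "maximal_commutative S R \<longleftrightarrow> subcring S R \<and> S = commutant R S"

definition monomial ::
  "'m cat \<Rightarrow> ('m \<Rightarrow> ('a, 'b) ring_scheme) \<Rightarrow> 'a \<Rightarrow> 'm \<Rightarrow> 'm \<Rightarrow> 'a" where
  "monomial G A a s = (\<lambda>r \<in> Mor G. if r = s then a else \<zero>\<^bsub>A (Cod G r)\<^esub>)"

context skew_system
begin

lemma Cod_in_Ob: "s \<in> Mor G \<Longrightarrow> Cod G s \<in> Ob G"
  by (simp add: Ob_def Cod_closed Dom_Cod)

lemma Dom_in_Ob: "s \<in> Mor G \<Longrightarrow> Dom G s \<in> Ob G"
  by (simp add: Ob_def Dom_closed Dom_Dom)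

lemma Cod_Ob: "e \<in> Ob G \<Longrightarrow> Cod G e = e"
  unfolding Ob_def using Cod_Dom by force

lemma monomial_closed:
  assumes "s \<in> Mor G" "a \<in> carrier (A (Cod G s))"
  shows "monomial G A a s \<in> carrier (skew_algebra G A \<sigma>)"
proof -
  have "skew_support G A (monomial G A a s) \<subseteq> {s}"
    by (auto simp: skew_support_def monomial_def)
  then have "finite (skew_support G A (monomial G A a s))"
    using finite_subset by blast
  moreover have "\<zero>\<^bsub>A (Cod G r)\<^esub> \<in> carrier (A (Cod G r))" if "r \<in> Mor G" for r
    using ring_A[OF Cod_in_Ob[OF that]] by (simp add: ring.ring_simprules)
  ultimately show ?thesis
    using assms by (auto simp: skew_algebra_def monomial_def)
qed

lemma monomial_mult:
  assumes s: "s \<in> Mor G" and t: "t \<in> Mor G"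
    and a: "a \<in> carrier (A (Cod G s))" and b: "b \<in> carrier (A (Cod G t))"
  shows "monomial G A a s \<otimes>\<^bsub>skew_algebra G A \<sigma>\<^esub> monomial G A b t =
    (if (s, t) \<in> composable G then monomial G A (a \<otimes>\<^bsub>A (Cod G s)\<^esub> \<sigma> s b) (s \<diamondop> t)
     else \<zero>\<^bsub>skew_algebra G A \<sigma>\<^esub>)"
proof
  fix r
  let ?x = "monomial G A a s" and ?y = "monomial G A b t"
  let ?P = "{(s', t'). (s', t') \<in> composable G \<and>
    s' \<in> skew_support G A ?x \<and> t' \<in> skew_support G A ?y \<and> s' \<diamondop> t' = r}"
  have P: "?P = (if (s, t) \<in> composable G \<and> a \<noteq> \<zero>\<^bsub>A (Cod G s)\<^esub> \<and> b \<noteq> \<zero>\<^bsub>A (Cod G t)\<^esub> \<and> s \<diamondop> t = r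
      then {(s, t)} else {})"
    using s t by (auto simp: skew_support_def monomial_def split: if_splits)
  show "(?x \<otimes>\<^bsub>skew_algebra G A \<sigma>\<^esub> ?y) r =
    (if (s, t) \<in> composable G then monomial G A (a \<otimes>\<^bsub>A (Cod G s)\<^esub> \<sigma> s b) (s \<diamondop> t)
     else \<zero>\<^bsub>skew_algebra G A \<sigma>\<^esub>) r"
  proof (cases "r \<in> Mor G \<and> (s, t) \<in> composable G \<and> s \<diamondop> t = r")
    case False
    then show ?thesis
      using P by (auto simp: skew_algebra_def monomial_def abelian_monoid.finsum_empty
          ring.is_abelian_group[OF ring_A[OF Cod_in_Ob]] abelian_group.axioms(1))
  next
    case True
    then have st: "Dom G s = Cod G t" and r: "r \<in> Mor G" "s \<diamondop> t = r" "(s, t) \<in> composable G"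
      by (auto simp: composable_def)
    have cod: "Cod G r = Cod G s"
      using Cod_Cmp[OF s t st] r by simp
    interpret C: ring "A (Cod G s)"
      by (rule ring_A[OF Cod_in_Ob[OF s]])
    interpret D: ring "A (Cod G t)"
      by (rule ring_A[OF Cod_in_Ob[OF t]])
    have h: "\<sigma> s \<in> ring_hom (A (Cod G t)) (A (Cod G s))"
      using sigma_hom[OF s] st by simp
    have sb: "\<sigma> s b \<in> carrier (A (Cod G s))"
      using ring_hom_closed[OF h b] .
    have s0: "\<sigma> s \<zero>\<^bsub>A (Cod G t)\<^esub> = \<zero>\<^bsub>A (Cod G s)\<^esub>"
      using ring_hom_zero[OF h D.ring_axioms C.ring_axioms] .
    show ?thesis
    proof (cases "a \<noteq> \<zero>\<^bsub>A (Cod G s)\<^esub> \<and> b \<noteq> \<zero>\<^bsub>A (Cod G t)\<^esub>")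
      case True
      then have P': "?P = {(s, t)}"
        using P r by simp
      have "(?x \<otimes>\<^bsub>skew_algebra G A \<sigma>\<^esub> ?y) r = 
        finsum (A (Cod G s)) (\<lambda>(s', t'). ?x s' \<otimes>\<^bsub>A (Cod G s')\<^esub> \<sigma> s' (?y t')) {(s, t)}"
        using r(1) by (simp add: skew_algebra_def P' cod)
      also have "\<dots> = a \<otimes>\<^bsub>A (Cod G s)\<^esub> \<sigma> s b"
        using C.finsum_insert[of "{}" "(s, t)" "\<lambda>(s', t'). ?x s' \<otimes>\<^bsub>A (Cod G s')\<^esub> \<sigma> s' (?y t')"]
          s t a sb by (simp add: monomial_def C.finsum_empty)
      finally show ?thesis
        using r by (simp add: monomial_def)
    next
      case False
      then have P': "?P = {}"
        using P by auto
      have "a \<otimes>\<^bsub>A (Cod G s)\<^esub> \<sigma> s b = \<zero>\<^bsub>A (Cod G s)\<^esub>"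
        using False a sb s0 by auto
      moreover have "(?x \<otimes>\<^bsub>skew_algebra G A \<sigma>\<^esub> ?y) r = \<zero>\<^bsub>A (Cod G s)\<^esub>"
        using r(1) by (simp add: skew_algebra_def P' cod)
      ultimately show ?thesis
        using r by (simp add: monomial_def)
    qed
  qed
qed

end

end

theory Submission
  imports Defs
begin

text \<open>
Write \<open>R\<close> for the skew groupoid algebra. As \<open>A\<close> is commutative, it lies in its own commutant, so
maximal commutativity means that every element commuting with \<open>A\<close> lies in \<open>A\<close>.

Suppose this holds, and let \<open>I\<close> be a nonzero ideal. Choose a nonzero \<open>x\<close> in \<open>I\<close> whose support is as
small as possible. Since morphisms are invertible, right multiplication by some \<open>u\<^sub>t\<close> moves a
nonzero coefficient of \<open>x\<close> to an identity \<open>e\<close> without enlarging the support. For \<open>y\<close> in \<open>A\<close>, the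
commutator of \<open>x\<close> and \<open>y\<close> lies in \<open>I\<close>, and its support is contained in that of \<open>x\<close> but misses \<open>e\<close>,
because \<open>A\<^sub>e\<close> is commutative. By minimality the commutator vanishes, so \<open>x\<close> commutes with \<open>A\<close> and
is a nonzero element of \<open>I \<inter> A\<close> (lemma \<open>ideal_meets_base_ring\<close>).

For the converse, let \<open>R\<close> act on \<open>A\<close> by \<open>(a u\<^sub>s) \<cdot> m = a \<sigma>\<^sub>s(m)\<close>. The annihilator of this action
is an ideal, and it meets \<open>A\<close> in zero because \<open>x \<cdot> 1 = x\<close> for \<open>x\<close> in \<open>A\<close>. So, if every nonzero
ideal meets \<open>A\<close>, the action is faithful. Suppose an element commuting with \<open>A\<close> has a nonzero
coefficient \<open>a\<close> at a morphism \<open>s\<close>. Comparing coefficients shows that \<open>s\<close> is an endomorphism of an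
object \<open>e\<close> and that \<open>a \<sigma>\<^sub>s(b) = a b\<close> for all \<open>b\<close> in \<open>A\<^sub>e\<close> (lemma \<open>commutant_coeff\<close>). Thus
\<open>a u\<^sub>e - a u\<^sub>s\<close> annihilates \<open>A\<close>, and faithfulness forces \<open>s = e\<close>
(lemma \<open>commutant_subset_base_ring\<close>).

The ring axioms for \<open>R\<close> and the module law for the action are bilinear identities, so by
\<open>skew_algebra_induct\<close> it suffices to check them on the terms \<open>a u\<^sub>s\<close>.
\<close>

section \<open>The skew category algebra is a ring\<close>

context skew_system
begin

abbreviation R :: "('m \<Rightarrow> 'a) ring" where
  "R \<equiv> skew_algebra G A \<sigma>"

abbreviation supp :: "('m \<Rightarrow> 'a) \<Rightarrow> 'm set" where
  "supp \<equiv> skew_support G A"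

lemma Ob_Mor: "e \<in> Ob G \<Longrightarrow> e \<in> Mor G"
  and Dom_Ob: "e \<in> Ob G \<Longrightarrow> Dom G e = e"
  by (auto simp: Ob_def)

lemma ring_Cod: "s \<in> Mor G \<Longrightarrow> ring (A (Cod G s))"
  and ring_Dom: "s \<in> Mor G \<Longrightarrow> ring (A (Dom G s))"
  by (simp_all add: ring_A Cod_in_Ob Dom_in_Ob)

lemma sigma_closed: "\<lbrakk>s \<in> Mor G; b \<in> carrier (A (Dom G s))\<rbrakk> \<Longrightarrow> \<sigma> s b \<in> carrier (A (Cod G s))"
  by (rule ring_hom_closed[OF sigma_hom])

lemma sigma_zero: "s \<in> Mor G \<Longrightarrow> \<sigma> s \<zero>\<^bsub>A (Dom G s)\<^esub> = \<zero>\<^bsub>A (Cod G s)\<^esub>"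
  by (rule ring_hom_zero[OF sigma_hom ring_Dom ring_Cod])

lemma sigma_one: "s \<in> Mor G \<Longrightarrow> \<sigma> s \<one>\<^bsub>A (Dom G s)\<^esub> = \<one>\<^bsub>A (Cod G s)\<^esub>"
  by (rule ring_hom_one[OF sigma_hom])

lemma carrier_iff: "x \<in> carrier R \<longleftrightarrow>
    x \<in> (\<Pi>\<^sub>E s \<in> Mor G. carrier (A (Cod G s))) \<and> finite (supp x)"
  by (simp add: skew_algebra_def)

lemma coeff_closed: "\<lbrakk>x \<in> carrier R; s \<in> Mor G\<rbrakk> \<Longrightarrow> x s \<in> carrier (A (Cod G s))"
  by (auto simp: carrier_iff)

lemma finite_supp: "x \<in> carrier R \<Longrightarrow> finite (supp x)"
  by (simp add: carrier_iff)

lemma supp_Mor: "supp x \<subseteq> Mor G"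
  and not_supp: "\<lbrakk>s \<in> Mor G; s \<notin> supp x\<rbrakk> \<Longrightarrow> x s = \<zero>\<^bsub>A (Cod G s)\<^esub>"
  by (auto simp: skew_support_def)

lemma skew_eqI:
  assumes "x \<in> carrier R" "y \<in> carrier R" "\<And>s. s \<in> Mor G \<Longrightarrow> x s = y s"
  shows "x = y"
  using assms by (auto simp: carrier_iff intro: PiE_ext)

lemma zero_coeff: "s \<in> Mor G \<Longrightarrow> \<zero>\<^bsub>R\<^esub> s = \<zero>\<^bsub>A (Cod G s)\<^esub>"
  and add_coeff: "s \<in> Mor G \<Longrightarrow> (x \<oplus>\<^bsub>R\<^esub> y) s = x s \<oplus>\<^bsub>A (Cod G s)\<^esub> y s"
  by (simp_all add: skew_algebra_def)

lemma zero_closed: "\<zero>\<^bsub>R\<^esub> \<in> carrier R"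
proof -
  have "supp \<zero>\<^bsub>R\<^esub> = {}"
    by (auto simp: skew_support_def zero_coeff)
  moreover have "\<zero>\<^bsub>R\<^esub> \<in> (\<Pi>\<^sub>E s \<in> Mor G. carrier (A (Cod G s)))"
    by (auto simp: skew_algebra_def ring.ring_simprules(2) ring_Cod)
  ultimately show ?thesis
    by (simp add: carrier_iff)
qed

lemma supp_empty_iff: "x \<in> carrier R \<Longrightarrow> supp x = {} \<longleftrightarrow> x = \<zero>\<^bsub>R\<^esub>"
  by (auto simp: skew_support_def zero_coeff intro!: skew_eqI zero_closed)

lemma supp_add: "supp (x \<oplus>\<^bsub>R\<^esub> y) \<subseteq> supp x \<union> supp y"
proof
  fix s assume s: "s \<in> supp (x \<oplus>\<^bsub>R\<^esub> y)"
  then interpret C: ring "A (Cod G s)"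
    using supp_Mor ring_Cod by blast
  show "s \<in> supp x \<union> supp y"
    using s by (auto simp: skew_support_def add_coeff)
qed

lemma add_closed:
  assumes "x \<in> carrier R" "y \<in> carrier R"
  shows "x \<oplus>\<^bsub>R\<^esub> y \<in> carrier R"
proof -
  have "x \<oplus>\<^bsub>R\<^esub> y \<in> (\<Pi>\<^sub>E s \<in> Mor G. carrier (A (Cod G s)))"
    using assms by (auto simp: skew_algebra_def ring.ring_simprules(1) ring_Cod coeff_closed)
  moreover have "finite (supp (x \<oplus>\<^bsub>R\<^esub> y))"
    using finite_subset[OF supp_add] assms by (auto simp: finite_supp)
  ultimately show ?thesis
    by (simp add: carrier_iff)
qed

lemma abelian_group_R: "abelian_group R"
proof (rule abelian_groupI)
  fix x assume x: "x \<in> carrier R"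
  define y where "y = (\<lambda>s \<in> Mor G. \<ominus>\<^bsub>A (Cod G s)\<^esub> x s)"
  have "supp y \<subseteq> supp x"
  proof
    fix s assume s: "s \<in> supp y"
    then have m: "s \<in> Mor G"
      using supp_Mor by blast
    interpret C: ring "A (Cod G s)"
      by (rule ring_Cod[OF m])
    show "s \<in> supp x"
      using s m by (auto simp: skew_support_def y_def)
  qed
  then have "finite (supp y)"
    using finite_subset finite_supp[OF x] by blast
  then have y: "y \<in> carrier R"
    using x by (auto simp: carrier_iff y_def ring.ring_simprules(3) ring_Cod coeff_closed)
  have "y \<oplus>\<^bsub>R\<^esub> x = \<zero>\<^bsub>R\<^esub>"
    by (rule skew_eqI) (use x y in \<open>simp_all add: add_closed zero_closed add_coeff zero_coeff y_def
        coeff_closed ring.ring_simprules(9) ring_Cod\<close>)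
  then show "\<exists>y \<in> carrier R. y \<oplus>\<^bsub>R\<^esub> x = \<zero>\<^bsub>R\<^esub>"
    using y by blast
qed (auto intro!: skew_eqI simp: add_closed zero_closed add_coeff zero_coeff coeff_closed
    ring.ring_simprules(7,8,10) ring_Cod)

lemma term_closed:
  assumes "(s, t) \<in> composable G" "a \<in> carrier (A (Cod G s))" "b \<in> carrier (A (Cod G t))"
  shows "a \<otimes>\<^bsub>A (Cod G s)\<^esub> \<sigma> s b \<in> carrier (A (Cod G s))"
proof -
  have "s \<in> Mor G" "Cod G t = Dom G s"
    using assms(1) by (auto simp: composable_def)
  then show ?thesis
    using assms by (simp add: ring.ring_simprules(5) ring_Cod sigma_closed)
qed

lemma term_zero:
  assumes "(s, t) \<in> composable G" "a \<in> carrier (A (Cod G s))" "b \<in> carrier (A (Cod G t))"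
    and "a = \<zero>\<^bsub>A (Cod G s)\<^esub> \<or> b = \<zero>\<^bsub>A (Cod G t)\<^esub>"
  shows "a \<otimes>\<^bsub>A (Cod G s)\<^esub> \<sigma> s b = \<zero>\<^bsub>A (Cod G s)\<^esub>"
proof -
  have s: "s \<in> Mor G" "Cod G t = Dom G s"
    using assms(1) by (auto simp: composable_def)
  interpret C: ring "A (Cod G s)"
    by (rule ring_Cod[OF s(1)])
  show ?thesis
    using assms s by (auto simp: sigma_closed sigma_zero)
qed

lemma composable_Cod: "(s, t) \<in> composable G \<Longrightarrow> Cod G (s \<diamondop> t) = Cod G s"
  by (auto simp: composable_def Cod_Cmp)

text \<open>
The sum defining a coefficient of a product runs over the supports of the two factors, so the sums
for \<open>x \<otimes> z\<close>, \<open>y \<otimes> z\<close> and \<open>(x \<oplus> y) \<otimes> z\<close> have different index sets. Allowing larger finite sets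
lets them be compared over a common one, since the additional terms vanish.
\<close>

lemma mult_coeff_of_supersets:
  assumes x: "x \<in> carrier R" and y: "y \<in> carrier R" and r: "r \<in> Mor G"
    and F: "finite F" "supp x \<subseteq> F" and K: "finite K" "supp y \<subseteq> K"
  shows "(x \<otimes>\<^bsub>R\<^esub> y) r = finsum (A (Cod G r)) (\<lambda>(s, t). x s \<otimes>\<^bsub>A (Cod G r)\<^esub> \<sigma> s (y t))
    {(s, t) \<in> F \<times> K. (s, t) \<in> composable G \<and> s \<diamondop> t = r}"
proof -
  interpret C: ring "A (Cod G r)"
    by (rule ring_Cod[OF r])
  let ?P = "{(s, t). (s, t) \<in> composable G \<and> s \<in> supp x \<and> t \<in> supp y \<and> s \<diamondop> t = r}"
  let ?Q = "{(s, t) \<in> F \<times> K. (s, t) \<in> composable G \<and> s \<diamondop> t = r}"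
  have Q: "x s \<otimes>\<^bsub>A (Cod G r)\<^esub> \<sigma> s (y t) \<in> carrier (A (Cod G r)) \<and>
      (s \<notin> supp x \<or> t \<notin> supp y \<longrightarrow> x s \<otimes>\<^bsub>A (Cod G r)\<^esub> \<sigma> s (y t) = \<zero>\<^bsub>A (Cod G r)\<^esub>)"
    if "(s, t) \<in> ?Q" for s t
  proof -
    have st: "(s, t) \<in> composable G" "Cod G r = Cod G s" "s \<in> Mor G" "t \<in> Mor G"
      using that composable_Cod by (auto simp: composable_def)
    show ?thesis
      using term_closed[OF st(1) coeff_closed[OF x] coeff_closed[OF y]]
        term_zero[OF st(1) coeff_closed[OF x] coeff_closed[OF y]] st
      by (auto simp: not_supp)
  qed
  have "(x \<otimes>\<^bsub>R\<^esub> y) r = finsum (A (Cod G r)) (\<lambda>(s, t). x s \<otimes>\<^bsub>A (Cod G s)\<^esub> \<sigma> s (y t)) ?P"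
    using r by (simp add: skew_algebra_def)
  also have "\<dots> = finsum (A (Cod G r)) (\<lambda>(s, t). x s \<otimes>\<^bsub>A (Cod G r)\<^esub> \<sigma> s (y t)) ?Q"
  proof (rule C.add.finprod_mono_neutral_cong_left)
    show "finite ?Q"
      using F K by (auto intro: finite_subset[of _ "F \<times> K"])
  qed (use F K Q composable_Cod in auto)
  finally show ?thesis .
qed

text \<open>
The case of a coefficient to which only one pair of morphisms can contribute. It covers all
products with an element of the base ring and all products with a term \<open>a u\<^sub>t\<close> of a groupoid.
\<close>

lemma mult_coeff_single:
  assumes x: "x \<in> carrier R" and y: "y \<in> carrier R" and st: "(s, t) \<in> composable G"
    and unique: "\<And>s' t'. \<lbrakk>(s', t') \<in> composable G; s' \<in> supp x; t' \<in> supp y; s' \<diamondop> t' = s \<diamondop> t\<rbrakk>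
      \<Longrightarrow> s' = s \<and> t' = t"
  shows "(x \<otimes>\<^bsub>R\<^esub> y) (s \<diamondop> t) = x s \<otimes>\<^bsub>A (Cod G s)\<^esub> \<sigma> s (y t)"
proof -
  have m: "s \<in> Mor G" "t \<in> Mor G" "s \<diamondop> t \<in> Mor G"
    using st Cmp_closed by (auto simp: composable_def)
  interpret C: ring "A (Cod G s)"
    by (rule ring_Cod[OF m(1)])
  let ?P = "{(s', t'). (s', t') \<in> composable G \<and> s' \<in> supp x \<and> t' \<in> supp y \<and> s' \<diamondop> t' = s \<diamondop> t}"
  have "(x \<otimes>\<^bsub>R\<^esub> y) (s \<diamondop> t) =
      finsum (A (Cod G s)) (\<lambda>(s, t). x s \<otimes>\<^bsub>A (Cod G s)\<^esub> \<sigma> s (y t)) ?P"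
    using m composable_Cod[OF st] by (simp add: skew_algebra_def)
  also have "\<dots> = finsum (A (Cod G s)) (\<lambda>(s, t). x s \<otimes>\<^bsub>A (Cod G s)\<^esub> \<sigma> s (y t)) {(s, t)}"
    by (rule C.add.finprod_mono_neutral_cong_left)
      (use unique st m x y not_supp[of s x] not_supp[of t y] in \<open>auto simp: coeff_closed term_closed
        ring.ring_simprules(2) ring_Cod
        intro!: term_zero[OF st]\<close>)
  also have "\<dots> = x s \<otimes>\<^bsub>A (Cod G s)\<^esub> \<sigma> s (y t)"
    using term_closed[OF st] x y m by (simp add: coeff_closed C.finsum_insert[of "{}"])
  finally show ?thesis .
qed

lemma supp_mult:
  "supp (x \<otimes>\<^bsub>R\<^esub> y) \<subseteq> {s \<diamondop> t | s t. (s, t) \<in> composable G \<and> s \<in> supp x \<and> t \<in> supp y}"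
proof
  fix r assume r: "r \<in> supp (x \<otimes>\<^bsub>R\<^esub> y)"
  then have m: "r \<in> Mor G"
    using supp_Mor by blast
  interpret C: ring "A (Cod G r)"
    by (rule ring_Cod[OF m])
  let ?P = "{(s, t). (s, t) \<in> composable G \<and> s \<in> supp x \<and> t \<in> supp y \<and> s \<diamondop> t = r}"
  have "?P \<noteq> {}"
  proof
    assume *: "?P = {}"
    have "(x \<otimes>\<^bsub>R\<^esub> y) r = \<zero>\<^bsub>A (Cod G r)\<^esub>"
      using m by (simp add: skew_algebra_def *)
    then show False
      using r by (simp add: skew_support_def)
  qed
  then show "r \<in> {s \<diamondop> t | s t. (s, t) \<in> composable G \<and> s \<in> supp x \<and> t \<in> supp y}"
    by auto
qed

lemma mult_closed:
  assumes x: "x \<in> carrier R" and y: "y \<in> carrier R"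
  shows "x \<otimes>\<^bsub>R\<^esub> y \<in> carrier R"
proof -
  have "(x \<otimes>\<^bsub>R\<^esub> y) r \<in> carrier (A (Cod G r))" if r: "r \<in> Mor G" for r
  proof -
    interpret C: ring "A (Cod G r)"
      by (rule ring_Cod[OF r])
    have "x s \<otimes>\<^bsub>A (Cod G r)\<^esub> \<sigma> s (y t) \<in> carrier (A (Cod G r))"
      if "(s, t) \<in> composable G" "s \<diamondop> t = r" for s t
      using that term_closed[OF that(1) coeff_closed[OF x] coeff_closed[OF y]] composable_Cod[OF that(1)]
      by (auto simp: composable_def)
    then show ?thesis
      unfolding mult_coeff_of_supersets[OF x y r finite_supp[OF x] order.refl finite_supp[OF y] order.refl]
      by (intro C.finsum_closed) auto
  qed
  moreover have "(x \<otimes>\<^bsub>R\<^esub> y) \<in> extensional (Mor G)"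
    by (simp add: skew_algebra_def)
  moreover have "finite (supp (x \<otimes>\<^bsub>R\<^esub> y))"
  proof (rule finite_subset[OF supp_mult])
    show "finite {s \<diamondop> t | s t. (s, t) \<in> composable G \<and> s \<in> supp x \<and> t \<in> supp y}"
      by (rule finite_subset[of _ "(\<lambda>(s, t). s \<diamondop> t) ` (supp x \<times> supp y)"])
        (auto simp: finite_supp x y)
  qed
  ultimately show ?thesis
    by (auto simp: carrier_iff PiE_def)
qed

lemma mult_distrib:
  assumes x: "x \<in> carrier R" and y: "y \<in> carrier R" and z: "z \<in> carrier R"
  shows "(x \<oplus>\<^bsub>R\<^esub> y) \<otimes>\<^bsub>R\<^esub> z = x \<otimes>\<^bsub>R\<^esub> z \<oplus>\<^bsub>R\<^esub> y \<otimes>\<^bsub>R\<^esub> z"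
    and "z \<otimes>\<^bsub>R\<^esub> (x \<oplus>\<^bsub>R\<^esub> y) = z \<otimes>\<^bsub>R\<^esub> x \<oplus>\<^bsub>R\<^esub> z \<otimes>\<^bsub>R\<^esub> y"
proof -
  let ?F = "supp x \<union> supp y" and ?K = "supp z"
  have fin: "finite ?F" "finite ?K" "supp x \<subseteq> ?F" "supp y \<subseteq> ?F" "supp z \<subseteq> ?K" "supp (x \<oplus>\<^bsub>R\<^esub> y) \<subseteq> ?F"
    using x y z supp_add by (auto simp: finite_supp)
  have terms: "s \<in> Mor G \<and> t \<in> Mor G \<and> Cod G r = Cod G s \<and> Cod G t = Dom G s"
    if "(s, t) \<in> composable G" "s \<diamondop> t = r" for s t r
    using that composable_Cod by (auto simp: composable_def)
  show "(x \<oplus>\<^bsub>R\<^esub> y) \<otimes>\<^bsub>R\<^esub> z = x \<otimes>\<^bsub>R\<^esub> z \<oplus>\<^bsub>R\<^esub> y \<otimes>\<^bsub>R\<^esub> z"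
  proof (rule skew_eqI)
    fix r assume r: "r \<in> Mor G"
    interpret C: ring "A (Cod G r)"
      by (rule ring_Cod[OF r])
    let ?Q = "{(s, t) \<in> ?F \<times> ?K. (s, t) \<in> composable G \<and> s \<diamondop> t = r}"
    let ?f = "\<lambda>w (s, t). w s \<otimes>\<^bsub>A (Cod G r)\<^esub> \<sigma> s (z t)"
    have Q: "(case p of (s, t) \<Rightarrow> w s \<in> carrier (A (Cod G r)) \<and> \<sigma> s (z t) \<in> carrier (A (Cod G r)))"
      if "p \<in> ?Q" "w \<in> carrier R" for p w
      using that terms z by (auto simp: coeff_closed) (metis coeff_closed sigma_closed terms)+
    have f: "?f w \<in> ?Q \<rightarrow> carrier (A (Cod G r))" if "w \<in> carrier R" for w
      using Q[OF _ that] C.m_closed by fastforce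
    have "((x \<oplus>\<^bsub>R\<^esub> y) \<otimes>\<^bsub>R\<^esub> z) r = finsum (A (Cod G r)) (?f (x \<oplus>\<^bsub>R\<^esub> y)) ?Q"
      using x y z r fin by (simp add: mult_coeff_of_supersets[of _ _ r "?F" "?K"] add_closed)
    also have "\<dots> = finsum (A (Cod G r)) (\<lambda>p. ?f x p \<oplus>\<^bsub>A (Cod G r)\<^esub> ?f y p) ?Q"
    proof (rule C.finsum_cong'[OF refl])
      fix p assume p: "p \<in> ?Q"
      obtain s t where "p = (s, t)"
        by force
      then show "?f (x \<oplus>\<^bsub>R\<^esub> y) p = ?f x p \<oplus>\<^bsub>A (Cod G r)\<^esub> ?f y p"
        using p Q[OF p x] Q[OF p y] terms[of s t r] C.l_distr[of "x s" "y s" "\<sigma> s (z t)"]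
        by (auto simp: add_coeff)
    qed (intro Pi_I C.a_closed; use f[OF x] f[OF y] in blast)
    also have "\<dots> = finsum (A (Cod G r)) (?f x) ?Q \<oplus>\<^bsub>A (Cod G r)\<^esub> finsum (A (Cod G r)) (?f y) ?Q"
      by (rule C.finsum_addf[OF f[OF x] f[OF y]])
    also have "\<dots> = (x \<otimes>\<^bsub>R\<^esub> z \<oplus>\<^bsub>R\<^esub> y \<otimes>\<^bsub>R\<^esub> z) r"
      using x y z r fin by (simp add: mult_coeff_of_supersets[of _ _ r "?F" "?K"] add_coeff)
    finally show "((x \<oplus>\<^bsub>R\<^esub> y) \<otimes>\<^bsub>R\<^esub> z) r = (x \<otimes>\<^bsub>R\<^esub> z \<oplus>\<^bsub>R\<^esub> y \<otimes>\<^bsub>R\<^esub> z) r" .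
  qed (use x y z in \<open>simp_all add: mult_closed add_closed\<close>)
  show "z \<otimes>\<^bsub>R\<^esub> (x \<oplus>\<^bsub>R\<^esub> y) = z \<otimes>\<^bsub>R\<^esub> x \<oplus>\<^bsub>R\<^esub> z \<otimes>\<^bsub>R\<^esub> y"
  proof (rule skew_eqI)
    fix r assume r: "r \<in> Mor G"
    interpret C: ring "A (Cod G r)"
      by (rule ring_Cod[OF r])
    let ?Q = "{(s, t) \<in> ?K \<times> ?F. (s, t) \<in> composable G \<and> s \<diamondop> t = r}"
    let ?f = "\<lambda>w (s, t). z s \<otimes>\<^bsub>A (Cod G r)\<^esub> \<sigma> s (w t)"
    have Q: "(case p of (s, t) \<Rightarrow> z s \<in> carrier (A (Cod G r)) \<and> \<sigma> s (w t) \<in> carrier (A (Cod G r)))"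
      if "p \<in> ?Q" "w \<in> carrier R" for p w
      using that terms z by (auto simp: coeff_closed) (metis coeff_closed sigma_closed terms)+
    have f: "?f w \<in> ?Q \<rightarrow> carrier (A (Cod G r))" if "w \<in> carrier R" for w
      using Q[OF _ that] C.m_closed by fastforce
    have "(z \<otimes>\<^bsub>R\<^esub> (x \<oplus>\<^bsub>R\<^esub> y)) r = finsum (A (Cod G r)) (?f (x \<oplus>\<^bsub>R\<^esub> y)) ?Q"
      using x y z r fin by (simp add: mult_coeff_of_supersets[of _ _ r "?K" "?F"] add_closed)
    also have "\<dots> = finsum (A (Cod G r)) (\<lambda>p. ?f x p \<oplus>\<^bsub>A (Cod G r)\<^esub> ?f y p) ?Q"
    proof (rule C.finsum_cong'[OF refl])
      fix p assume p: "p \<in> ?Q"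
      obtain s t where st: "p = (s, t)"
        by force
      then have m: "s \<in> Mor G" "t \<in> Mor G" "Cod G r = Cod G s" "Cod G t = Dom G s"
        using p terms[of s t r] by auto
      have "\<sigma> s ((x \<oplus>\<^bsub>R\<^esub> y) t) = \<sigma> s (x t) \<oplus>\<^bsub>A (Cod G r)\<^esub> \<sigma> s (y t)"
        using m x y coeff_closed[of _ t] by (simp add: add_coeff ring_hom_add[OF sigma_hom])
      then show "?f (x \<oplus>\<^bsub>R\<^esub> y) p = ?f x p \<oplus>\<^bsub>A (Cod G r)\<^esub> ?f y p"
        using p Q[OF p x] Q[OF p y] st by (auto simp: C.r_distr)
    qed (intro Pi_I C.a_closed; use f[OF x] f[OF y] in blast)
    also have "\<dots> = finsum (A (Cod G r)) (?f x) ?Q \<oplus>\<^bsub>A (Cod G r)\<^esub> finsum (A (Cod G r)) (?f y) ?Q"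
      by (rule C.finsum_addf[OF f[OF x] f[OF y]])
    also have "\<dots> = (z \<otimes>\<^bsub>R\<^esub> x \<oplus>\<^bsub>R\<^esub> z \<otimes>\<^bsub>R\<^esub> y) r"
      using x y z r fin by (simp add: mult_coeff_of_supersets[of _ _ r "?K" "?F"] add_coeff)
    finally show "(z \<otimes>\<^bsub>R\<^esub> (x \<oplus>\<^bsub>R\<^esub> y)) r = (z \<otimes>\<^bsub>R\<^esub> x \<oplus>\<^bsub>R\<^esub> z \<otimes>\<^bsub>R\<^esub> y) r" .
  qed (use x y z in \<open>simp_all add: mult_closed add_closed\<close>)
qed

text \<open>
Splitting off one coefficient at a time shows that the terms \<open>a u\<^sub>s\<close> generate the additive group.
\<close>

lemma skew_algebra_induct [consumes 1, case_names zero monomial add]: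
  assumes x: "x \<in> carrier R"
    and zero: "P \<zero>\<^bsub>R\<^esub>"
    and monomial: "\<And>s a. \<lbrakk>s \<in> Mor G; a \<in> carrier (A (Cod G s))\<rbrakk> \<Longrightarrow> P (monomial G A a s)"
    and add: "\<And>x y. \<lbrakk>x \<in> carrier R; y \<in> carrier R; P x; P y\<rbrakk> \<Longrightarrow> P (x \<oplus>\<^bsub>R\<^esub> y)"
  shows "P x"
  using x
proof (induction "card (supp x)" arbitrary: x rule: less_induct)
  case less
  show ?case
  proof (cases "supp x = {}")
    case True
    then show ?thesis
      using less.prems zero supp_empty_iff by auto
  next
    case False
    then obtain s where s: "s \<in> supp x"
      by blast
    then have m: "s \<in> Mor G"
      using supp_Mor by blast
    define y where "y = x(s := \<zero>\<^bsub>A (Cod G s)\<^esub>)"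
    have supp_y: "supp y = supp x - {s}"
      using m by (auto simp: skew_support_def y_def)
    have y: "y \<in> carrier R"
      using less.prems supp_y m
      by (auto simp: carrier_iff y_def ring.ring_simprules(2) ring_Cod PiE_def extensional_def)
    have "card (supp y) < card (supp x)"
      unfolding supp_y using s less.prems by (intro card_Diff1_less) (auto simp: finite_supp)
    then have "P y"
      using less.hyps y by blast
    moreover have "x = monomial G A (x s) s \<oplus>\<^bsub>R\<^esub> y"
    proof (rule skew_eqI)
      fix r assume r: "r \<in> Mor G"
      show "x r = (monomial G A (x s) s \<oplus>\<^bsub>R\<^esub> y) r"
        using r less.prems by (auto simp: add_coeff monomial_def y_def coeff_closed
            ring.ring_simprules(8,15) ring_Cod)
    qed (use less.prems m y in \<open>auto simp: add_closed monomial_closed coeff_closed\<close>)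
    ultimately show ?thesis
      using add[OF monomial_closed y monomial] m less.prems coeff_closed by metis
  qed
qed

lemma mult_zero:
  assumes "x \<in> carrier R"
  shows "\<zero>\<^bsub>R\<^esub> \<otimes>\<^bsub>R\<^esub> x = \<zero>\<^bsub>R\<^esub>" "x \<otimes>\<^bsub>R\<^esub> \<zero>\<^bsub>R\<^esub> = \<zero>\<^bsub>R\<^esub>"
proof -
  have "supp \<zero>\<^bsub>R\<^esub> = {}"
    using supp_empty_iff zero_closed by blast
  then have "supp (\<zero>\<^bsub>R\<^esub> \<otimes>\<^bsub>R\<^esub> x) = {}" "supp (x \<otimes>\<^bsub>R\<^esub> \<zero>\<^bsub>R\<^esub>) = {}"
    using supp_mult by blast+
  then show "\<zero>\<^bsub>R\<^esub> \<otimes>\<^bsub>R\<^esub> x = \<zero>\<^bsub>R\<^esub>" "x \<otimes>\<^bsub>R\<^esub> \<zero>\<^bsub>R\<^esub> = \<zero>\<^bsub>R\<^esub>"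
    using assms zero_closed mult_closed supp_empty_iff by blast+
qed

lemma monomial_assoc:
  assumes m: "r \<in> Mor G" "s \<in> Mor G" "t \<in> Mor G"
    and a: "a \<in> carrier (A (Cod G r))" and b: "b \<in> carrier (A (Cod G s))"
    and c: "c \<in> carrier (A (Cod G t))"
  shows "(monomial G A a r \<otimes>\<^bsub>R\<^esub> monomial G A b s) \<otimes>\<^bsub>R\<^esub> monomial G A c t =
    monomial G A a r \<otimes>\<^bsub>R\<^esub> (monomial G A b s \<otimes>\<^bsub>R\<^esub> monomial G A c t)"
proof (cases "Dom G r = Cod G s \<and> Dom G s = Cod G t")
  case True
  then have rs: "(r, s) \<in> composable G" and st: "(s, t) \<in> composable G"
    and rs_t: "(r \<diamondop> s, t) \<in> composable G" and r_st: "(r, s \<diamondop> t) \<in> composable G"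
    using m by (auto simp: composable_def Cmp_closed Dom_Cmp Cod_Cmp)
  have mor: "r \<diamondop> s \<in> Mor G" "s \<diamondop> t \<in> Mor G"
    using m True by (auto simp: Cmp_closed)
  interpret C: ring "A (Cod G r)"
    by (rule ring_Cod[OF m(1)])
  have c': "c \<in> carrier (A (Dom G s))"
    using c True by simp
  have \<sigma>: "\<sigma> r b \<in> carrier (A (Cod G r))" "\<sigma> s c \<in> carrier (A (Cod G s))"
      "\<sigma> r (\<sigma> s c) \<in> carrier (A (Cod G r))"
    using m b c' True sigma_closed by metis+
  have h: "\<sigma> r (b \<otimes>\<^bsub>A (Cod G s)\<^esub> \<sigma> s c) = \<sigma> r b \<otimes>\<^bsub>A (Cod G r)\<^esub> \<sigma> r (\<sigma> s c)"
    using ring_hom_mult[OF sigma_hom[OF m(1)]] True b \<sigma> by simp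
  have rc: "\<sigma> r (\<sigma> s c) = \<sigma> (r \<diamondop> s) c"
    using sigma_Cmp[OF rs] c' by simp
  show ?thesis
    using m a b c rs st rs_t r_st mor term_closed[OF rs a b] term_closed[OF st b c]
      \<sigma> h rc True
    by (simp add: monomial_mult composable_Cod C.m_assoc Cmp_assoc)
next
  case False
  have mor: "(r, s) \<in> composable G \<Longrightarrow> r \<diamondop> s \<in> Mor G" "(s, t) \<in> composable G \<Longrightarrow> s \<diamondop> t \<in> Mor G"
    by (auto simp: composable_def Cmp_closed)
  have *: "(r, s) \<notin> composable G \<or> (s, t) \<notin> composable G"
    "(r, s) \<in> composable G \<Longrightarrow> (r \<diamondop> s, t) \<notin> composable G"
    "(s, t) \<in> composable G \<Longrightarrow> (r, s \<diamondop> t) \<notin> composable G"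
    using False m by (auto simp: composable_def Dom_Cmp Cod_Cmp)
  show ?thesis
    using m a b c * mor term_closed[of r s a b] term_closed[of s t b c]
    by (auto simp: monomial_mult composable_Cod mult_zero monomial_closed)
qed

lemma mult_assoc:
  assumes x: "x \<in> carrier R" and y: "y \<in> carrier R" and z: "z \<in> carrier R"
  shows "(x \<otimes>\<^bsub>R\<^esub> y) \<otimes>\<^bsub>R\<^esub> z = x \<otimes>\<^bsub>R\<^esub> (y \<otimes>\<^bsub>R\<^esub> z)"
  using x
proof (induction x rule: skew_algebra_induct)
  case (monomial r a)
  note x = monomial_closed[OF monomial]
  show ?case
    using y
  proof (induction y rule: skew_algebra_induct)
    case (monomial s b)
    note y = monomial_closed[OF monomial]
    show ?case
      using z
    proof (induction z rule: skew_algebra_induct)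
      case (monomial t c)
      then show ?case
        using \<open>r \<in> Mor G\<close> \<open>a \<in> carrier _\<close> \<open>s \<in> Mor G\<close> \<open>b \<in> carrier _\<close>
        by (simp add: monomial_assoc)
    qed (use x y in \<open>simp_all add: mult_zero mult_closed mult_distrib add_closed\<close>)
  qed (use x z in \<open>simp_all add: mult_zero mult_closed mult_distrib add_closed\<close>)
qed (use y z in \<open>simp_all add: mult_zero mult_closed mult_distrib add_closed\<close>)

lemma base_ringD:
  assumes "x \<in> base_ring G A \<sigma>"
  shows "x \<in> carrier R" "supp x \<subseteq> Ob G"
  using assms by (auto simp: base_ring_def)

text \<open>
An identity \<open>e\<close> composes with \<open>r\<close> on the right only if \<open>e = Dom G r\<close>, so multiplying by an element
of the base ring acts on each coefficient separately.
\<close>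

lemma mult_base_right:
  assumes x: "x \<in> carrier R" and y: "y \<in> base_ring G A \<sigma>" and r: "r \<in> Mor G"
  shows "(x \<otimes>\<^bsub>R\<^esub> y) r = x r \<otimes>\<^bsub>A (Cod G r)\<^esub> \<sigma> r (y (Dom G r))"
proof -
  have "(r, Dom G r) \<in> composable G"
    using r by (simp add: composable_def Dom_closed Cod_Dom)
  moreover have "s' = r \<and> t' = Dom G r"
    if "(s', t') \<in> composable G" "t' \<in> supp y" "s' \<diamondop> t' = r \<diamondop> Dom G r" for s' t'
  proof -
    have t': "t' \<in> Ob G"
      using that base_ringD[OF y] by auto
    have s': "s' \<in> Mor G" "Dom G s' = t'"
      using that Cod_Ob[OF t'] by (auto simp: composable_def)
    then show ?thesis
      using that Cmp_Dom[OF r] Cmp_Dom[OF s'(1)] by simp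
  qed
  ultimately show ?thesis
    using mult_coeff_single[OF x base_ringD(1)[OF y], of r "Dom G r"] Cmp_Dom[OF r] by auto
qed

lemma mult_base_left:
  assumes x: "x \<in> base_ring G A \<sigma>" and y: "y \<in> carrier R" and r: "r \<in> Mor G"
  shows "(x \<otimes>\<^bsub>R\<^esub> y) r = x (Cod G r) \<otimes>\<^bsub>A (Cod G r)\<^esub> y r"
proof -
  have "(Cod G r, r) \<in> composable G"
    using r by (simp add: composable_def Cod_closed Dom_Cod)
  moreover have "s' = Cod G r \<and> t' = r"
    if "(s', t') \<in> composable G" "s' \<in> supp x" "s' \<diamondop> t' = Cod G r \<diamondop> r" for s' t'
  proof -
    have s': "s' \<in> Ob G"
      using that base_ringD[OF x] by auto
    have t': "t' \<in> Mor G" "Cod G t' = s'"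
      using that Dom_Ob[OF s'] by (auto simp: composable_def)
    then show ?thesis
      using that Cod_Cmp_id[OF r] Cod_Cmp_id[OF t'(1)] by simp
  qed
  ultimately have "(x \<otimes>\<^bsub>R\<^esub> y) r = x (Cod G r) \<otimes>\<^bsub>A (Cod G r)\<^esub> \<sigma> (Cod G r) (y r)"
    using mult_coeff_single[OF base_ringD(1)[OF x] y, of "Cod G r" r] Cod_Cmp_id[OF r] Cod_Cod[OF r]
    by auto
  then show ?thesis
    by (simp add: sigma_id Cod_in_Ob r coeff_closed y)
qed

lemma one_coeff: "s \<in> Mor G \<Longrightarrow> \<one>\<^bsub>R\<^esub> s = (if s \<in> Ob G then \<one>\<^bsub>A s\<^esub> else \<zero>\<^bsub>A (Cod G s)\<^esub>)"
  by (simp add: skew_algebra_def)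

lemma one_in_base_ring:
  assumes "finite (Ob G)"
  shows "\<one>\<^bsub>R\<^esub> \<in> base_ring G A \<sigma>"
proof -
  have supp: "supp \<one>\<^bsub>R\<^esub> \<subseteq> Ob G"
    by (auto simp: skew_support_def one_coeff split: if_splits)
  have "\<one>\<^bsub>R\<^esub> \<in> (\<Pi>\<^sub>E s \<in> Mor G. carrier (A (Cod G s)))"
    by (auto simp: skew_algebra_def ring.ring_simprules(2,6) ring_Cod ring_A Cod_Ob)
  then show ?thesis
    using supp finite_subset[OF supp assms] by (simp add: base_ring_def carrier_iff)
qed

lemma ring_R:
  assumes "finite (Ob G)"
  shows "ring R"
proof (rule ringI[OF abelian_group_R])
  note one = one_in_base_ring[OF assms]
  have unit: "\<one>\<^bsub>R\<^esub> \<otimes>\<^bsub>R\<^esub> x = x" "x \<otimes>\<^bsub>R\<^esub> \<one>\<^bsub>R\<^esub> = x" if x: "x \<in> carrier R" for x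
    using x one base_ringD(1)[OF one]
    by (auto intro!: skew_eqI simp: mult_closed mult_base_left mult_base_right one_coeff
        Cod_closed Dom_closed Cod_in_Ob Dom_in_Ob sigma_one coeff_closed
        ring.ring_simprules(12) ring_Cod monoid.r_one[OF ring.is_monoid])
  show "monoid R"
    by (rule monoidI) (use unit base_ringD(1)[OF one] in \<open>simp_all add: mult_closed mult_assoc\<close>)
qed (simp_all add: mult_distrib)

lemma neg_coeff:
  assumes x: "x \<in> carrier R" and s: "s \<in> Mor G"
  shows "(\<ominus>\<^bsub>R\<^esub> x) s = \<ominus>\<^bsub>A (Cod G s)\<^esub> x s"
proof -
  interpret abelian_group R
    by (rule abelian_group_R)
  interpret C: ring "A (Cod G s)"
    by (rule ring_Cod[OF s])
  have "(\<ominus>\<^bsub>R\<^esub> x) s \<oplus>\<^bsub>A (Cod G s)\<^esub> x s = \<zero>\<^bsub>A (Cod G s)\<^esub>"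
    using l_neg[OF x] add_coeff[OF s] zero_coeff[OF s] by metis
  then show ?thesis
    using x s by (metis C.minus_equality a_inv_closed coeff_closed)
qed

lemma base_ring_subcring:
  assumes fin: "finite (Ob G)" and comm: "\<And>e. e \<in> Ob G \<Longrightarrow> cring (A e)"
  shows "subcring (base_ring G A \<sigma>) R"
proof -
  interpret ring R
    by (rule ring_R[OF fin])
  show ?thesis
  proof (rule subcringI[OF subringI])
    show "base_ring G A \<sigma> \<subseteq> carrier R"
      by (auto simp: base_ring_def)
    show "\<one>\<^bsub>R\<^esub> \<in> base_ring G A \<sigma>"
      by (rule one_in_base_ring[OF fin])
    fix x assume x: "x \<in> base_ring G A \<sigma>"
    note xD = base_ringD[OF x]
    have "supp (\<ominus>\<^bsub>R\<^esub> x) \<subseteq> supp x"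
      using xD ring.minus_zero[OF ring_Cod]
      by (auto simp: skew_support_def neg_coeff)
    then show "\<ominus>\<^bsub>R\<^esub> x \<in> base_ring G A \<sigma>"
      using xD by (auto simp: base_ring_def)
    fix y assume y: "y \<in> base_ring G A \<sigma>"
    note yD = base_ringD[OF y]
    show "x \<oplus>\<^bsub>R\<^esub> y \<in> base_ring G A \<sigma>"
      using xD yD supp_add[of x y] by (auto simp: base_ring_def)
    have "s \<diamondop> t \<in> Ob G" if "s \<in> Ob G" "t \<in> Ob G" "(s, t) \<in> composable G" for s t
      using that Cmp_Dom[of s] Dom_Ob Cod_Ob by (auto simp: composable_def)
    then show "x \<otimes>\<^bsub>R\<^esub> y \<in> base_ring G A \<sigma>"
      using xD yD supp_mult[of x y] by (fastforce simp: base_ring_def)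
    show "x \<otimes>\<^bsub>R\<^esub> y = y \<otimes>\<^bsub>R\<^esub> x"
    proof (rule skew_eqI)
      fix r assume r: "r \<in> Mor G"
      interpret C: cring "A (Cod G r)"
        by (rule comm[OF Cod_in_Ob[OF r]])
      show "(x \<otimes>\<^bsub>R\<^esub> y) r = (y \<otimes>\<^bsub>R\<^esub> x) r"
      proof (cases "r \<in> Ob G")
        case True
        then show ?thesis
          using x y xD yD r C.m_comm[of "x r" "y r"] coeff_closed[of _ r]
          by (simp add: mult_base_right mult_base_left Dom_Ob Cod_Ob sigma_id)
      next
        case False
        then have "x r = \<zero>\<^bsub>A (Cod G r)\<^esub>"
          using xD r not_supp by blast
        moreover have "\<sigma> r (y (Dom G r)) \<in> carrier (A (Cod G r))" "y (Cod G r) \<in> carrier (A (Cod G r))"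
          using r yD coeff_closed[of y "Cod G r"] coeff_closed[of y "Dom G r"]
          by (simp_all add: sigma_closed Dom_closed Cod_closed Cod_Dom Cod_Cod)
        ultimately show ?thesis
          by (simp add: mult_base_right[OF xD(1) y r] mult_base_left[OF y xD(1) r])
      qed
    qed (use xD yD in \<open>simp_all add: mult_closed\<close>)
  qed
qed

section \<open>Ideals of a skew groupoid algebra\<close>

text \<open>
A nonzero element of least support in \<open>I\<close>, translated so that its support contains an identity,
commutes with the base ring: its commutators lie in \<open>I\<close> and have strictly smaller support.
\<close>

lemma ideal_meets_base_ring:
  assumes gpd: "groupoid G" and comm: "\<And>e. e \<in> Ob G \<Longrightarrow> cring (A e)"
    and I: "ideal I R" and nonzero: "I \<noteq> {\<zero>\<^bsub>R\<^esub>}"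
    and maximal: "commutant R (base_ring G A \<sigma>) \<subseteq> base_ring G A \<sigma>"
  shows "I \<inter> base_ring G A \<sigma> \<noteq> {\<zero>\<^bsub>R\<^esub>}"
proof -
  interpret I: ideal I R
    by (rule I)
  obtain x0 where "x0 \<in> I \<and> x0 \<noteq> \<zero>\<^bsub>R\<^esub>"
    using nonzero additive_subgroup.zero_closed[OF I.is_additive_subgroup] by blast
  from ex_has_least_nat[of "\<lambda>x. x \<in> I \<and> x \<noteq> \<zero>\<^bsub>R\<^esub>", OF this, of "\<lambda>x. card (supp x)"]
  obtain x where x: "x \<in> I" "x \<noteq> \<zero>\<^bsub>R\<^esub>"
    and minimal: "\<And>y. \<lbrakk>y \<in> I; y \<noteq> \<zero>\<^bsub>R\<^esub>\<rbrakk> \<Longrightarrow> card (supp x) \<le> card (supp y)"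
    by auto
  have xR: "x \<in> carrier R"
    using x I.a_subset by blast
  obtain t where t: "t \<in> supp x"
    using x supp_empty_iff[OF xR] by blast
  then have tm: "t \<in> Mor G"
    using supp_Mor by blast
  obtain t' where t': "t' \<in> Mor G" "Dom G t' = Cod G t" "Cod G t' = Dom G t"
      "t \<diamondop> t' = Cod G t" "t' \<diamondop> t = Dom G t"
    using groupoid.invertible[OF gpd tm] by blast
  have comp: "(t, t') \<in> composable G"
    using tm t' by (simp add: composable_def)
  \<comment> \<open>Right multiplication by \<open>u\<close> moves the coefficient at \<open>t\<close> to the identity \<open>Cod G t\<close>.\<close>
  define u where "u = monomial G A \<one>\<^bsub>A (Cod G t')\<^esub> t'"
  have u: "u \<in> carrier R"
    unfolding u_def using t'(1) by (intro monomial_closed) (simp_all add: ring.ring_simprules(6) ring_Cod)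
  have supp_u: "supp u \<subseteq> {t'}" and u_t': "u t' = \<one>\<^bsub>A (Dom G t)\<^esub>"
    using t' by (auto simp: u_def skew_support_def monomial_def)
  define x' where "x' = x \<otimes>\<^bsub>R\<^esub> u"
  have x'I: "x' \<in> I" and x'R: "x' \<in> carrier R"
    using I.I_r_closed[OF x(1) u] mult_closed[OF xR u] by (simp_all add: x'_def)
  have "supp x' \<subseteq> (\<lambda>s. s \<diamondop> t') ` supp x"
    using supp_mult[of x u] supp_u by (auto simp: x'_def)
  then have card_x': "card (supp x') \<le> card (supp x)"
    using finite_supp[OF xR] surj_card_le by blast
  have "x' (t \<diamondop> t') = x t \<otimes>\<^bsub>A (Cod G t)\<^esub> \<sigma> t (u t')"
    unfolding x'_def
  proof (rule mult_coeff_single[OF xR u comp])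
    fix s' t'' assume *: "(s', t'') \<in> composable G" "t'' \<in> supp u" "s' \<diamondop> t'' = t \<diamondop> t'"
    then have s': "t'' = t'" "s' \<in> Mor G" "Dom G s' = Dom G t"
      using supp_u t' by (auto simp: composable_def)
    \<comment> \<open>Invertibility allows cancelling \<open>t'\<close>, so no second coefficient of \<open>x\<close> is added to the one at \<open>t\<close>.\<close>
    have "s' = (s' \<diamondop> t') \<diamondop> t"
      using s' t' tm Cmp_assoc[of s' t' t] Cmp_Dom[of s'] by simp
    also have "\<dots> = t"
      using * s' t' tm Cod_Cmp_id by simp
    finally show "s' = t \<and> t'' = t'"
      using s' by simp
  qed
  also have "\<dots> = x t"
    using tm xR by (simp add: u_t' sigma_one coeff_closed monoid.r_one[OF ring.is_monoid] ring_Cod)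
  finally have "x' (Cod G t) \<noteq> \<zero>\<^bsub>A (Cod G t)\<^esub>"
    using t t' by (simp add: skew_support_def)
  then have e: "Cod G t \<in> supp x'"
    using tm by (simp add: skew_support_def Cod_closed Cod_Cod)
  then have x'0: "x' \<noteq> \<zero>\<^bsub>R\<^esub>"
    using supp_empty_iff[OF x'R] by blast
  have "x' \<in> commutant R (base_ring G A \<sigma>)"
    unfolding commutant_def
  proof (intro CollectI conjI ballI x'R)
    fix y assume y: "y \<in> base_ring G A \<sigma>"
    note yR = base_ringD(1)[OF y]
    define z where "z = x' \<otimes>\<^bsub>R\<^esub> y \<ominus>\<^bsub>R\<^esub> y \<otimes>\<^bsub>R\<^esub> x'"
    have zI: "z \<in> I"
      unfolding z_def a_minus_def
      by (intro additive_subgroup.a_closed[OF I.is_additive_subgroup]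
          additive_subgroup.a_inv_closed[OF I.is_additive_subgroup]
          I.I_r_closed I.I_l_closed x'I yR)
    have coeff: "z r = x' r \<otimes>\<^bsub>A (Cod G r)\<^esub> \<sigma> r (y (Dom G r)) \<ominus>\<^bsub>A (Cod G r)\<^esub> y (Cod G r) \<otimes>\<^bsub>A (Cod G r)\<^esub> x' r"
      if "r \<in> Mor G" for r
      using that y yR x'R
      by (simp add: z_def a_minus_def add_coeff neg_coeff mult_closed mult_base_right mult_base_left)
    have "supp z \<subseteq> supp x' - {Cod G t}"
    proof
      fix r assume r: "r \<in> supp z"
      then have m: "r \<in> Mor G"
        using supp_Mor by blast
      interpret C: cring "A (Cod G r)"
        by (rule comm[OF Cod_in_Ob[OF m]])
      have closed: "\<sigma> r (y (Dom G r)) \<in> carrier (A (Cod G r))" "y (Cod G r) \<in> carrier (A (Cod G r))"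
          "x' r \<in> carrier (A (Cod G r))"
        using m yR x'R coeff_closed[of y "Cod G r"] coeff_closed[of y "Dom G r"]
        by (simp_all add: sigma_closed Dom_closed Cod_closed Cod_Dom Cod_Cod coeff_closed)
      have "z r \<noteq> \<zero>\<^bsub>A (Cod G r)\<^esub>"
        using r by (simp add: skew_support_def)
      then have ne: "x' r \<otimes>\<^bsub>A (Cod G r)\<^esub> \<sigma> r (y (Dom G r)) \<noteq> y (Cod G r) \<otimes>\<^bsub>A (Cod G r)\<^esub> x' r"
        using coeff[OF m] closed by (auto simp: C.r_right_minus_eq)
      then have "r \<in> supp x'"
        using m closed by (auto simp: skew_support_def)
      moreover have "r \<notin> Ob G"
        using ne closed C.m_comm by (auto simp: Dom_Ob Cod_Ob sigma_id)
      ultimately show "r \<in> supp x' - {Cod G t}"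
        using Cod_in_Ob[OF tm] by auto
    qed
    then have "supp z \<subset> supp x'"
      using e by blast
    then have "card (supp z) < card (supp x)"
      using psubset_card_mono[OF finite_supp[OF x'R]] card_x' by (meson order_less_le_trans)
    then have "z = \<zero>\<^bsub>R\<^esub>"
      using minimal[OF zI] by linarith
    then show "x' \<otimes>\<^bsub>R\<^esub> y = y \<otimes>\<^bsub>R\<^esub> x'"
      using x'R yR by (simp add: z_def I.r_right_minus_eq mult_closed)
  qed
  then show ?thesis
    using maximal x'I x'0 by auto
qed

section \<open>The action on the base ring\<close>

text \<open>
The action is defined on the product of the rings \<open>A e\<close>, whose elements are families indexed by
objects; this is the direct sum when there are finitely many objects. The values of a family
outside \<open>Ob G\<close> are arbitrary, so equations between families are stated at objects.
\<close>

abbreviation base_families :: "('m \<Rightarrow> 'a) set" where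
  "base_families \<equiv> \<Pi> e \<in> Ob G. carrier (A e)"

text \<open>
This extends \<open>(a u\<^sub>s) \<cdot> m = a \<sigma>\<^sub>s(m\<^sub>e)\<close>, with \<open>e = Dom G s\<close>, linearly in the acting element; the result
of such a term is concentrated at \<open>Cod G s\<close>.
\<close>

definition act :: "('m \<Rightarrow> 'a) \<Rightarrow> ('m \<Rightarrow> 'a) \<Rightarrow> 'm \<Rightarrow> 'a" where
  "act x m c = finsum (A c) (\<lambda>s. x s \<otimes>\<^bsub>A c\<^esub> \<sigma> s (m (Dom G s))) {s \<in> supp x. Cod G s = c}"

lemma act_term_closed:
  assumes "x \<in> carrier R" "m \<in> base_families" "s \<in> Mor G"
  shows "\<sigma> s (m (Dom G s)) \<in> carrier (A (Cod G s))"
    and "x s \<otimes>\<^bsub>A (Cod G s)\<^esub> \<sigma> s (m (Dom G s)) \<in> carrier (A (Cod G s))"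
proof -
  have "m (Dom G s) \<in> carrier (A (Dom G s))"
    using assms Dom_in_Ob by blast
  then show "\<sigma> s (m (Dom G s)) \<in> carrier (A (Cod G s))"
    using assms by (simp add: sigma_closed)
  then show "x s \<otimes>\<^bsub>A (Cod G s)\<^esub> \<sigma> s (m (Dom G s)) \<in> carrier (A (Cod G s))"
    using assms by (simp add: coeff_closed ring.ring_simprules(5) ring_Cod)
qed

lemma act_of_superset:
  assumes x: "x \<in> carrier R" and m: "m \<in> base_families" and c: "c \<in> Ob G"
    and F: "finite F" "supp x \<subseteq> F" "F \<subseteq> Mor G"
  shows "act x m c = finsum (A c) (\<lambda>s. x s \<otimes>\<^bsub>A c\<^esub> \<sigma> s (m (Dom G s))) {s \<in> F. Cod G s = c}"
proof -
  interpret C: ring "A c"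
    by (rule ring_A[OF c])
  show ?thesis
    unfolding act_def
  proof (rule C.add.finprod_mono_neutral_cong_left)
    fix s assume s: "s \<in> {s \<in> F. Cod G s = c} - {s \<in> supp x. Cod G s = c}"
    then have "x s = \<zero>\<^bsub>A c\<^esub>" "\<sigma> s (m (Dom G s)) \<in> carrier (A c)"
      using F not_supp[of s x] act_term_closed(1)[OF x m, of s] by auto
    then show "x s \<otimes>\<^bsub>A c\<^esub> \<sigma> s (m (Dom G s)) = \<zero>\<^bsub>A c\<^esub>"
      by simp
  qed (use F act_term_closed(2)[OF x m] in auto)
qed

lemma act_closed:
  assumes x: "x \<in> carrier R" and m: "m \<in> base_families"
  shows "act x m \<in> base_families"
proof
  fix c assume c: "c \<in> Ob G"
  interpret C: ring "A c"
    by (rule ring_A[OF c])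
  show "act x m c \<in> carrier (A c)"
    unfolding act_def
    by (rule C.finsum_closed) (use act_term_closed(2)[OF x m] supp_Mor in blast)
qed

lemma act_zero:
  assumes "c \<in> Ob G"
  shows "act \<zero>\<^bsub>R\<^esub> m c = \<zero>\<^bsub>A c\<^esub>"
proof -
  interpret C: ring "A c"
    by (rule ring_A[OF assms])
  have "supp \<zero>\<^bsub>R\<^esub> = {}"
    using supp_empty_iff zero_closed by blast
  then show ?thesis
    by (simp add: act_def)
qed

lemma act_zero_right:
  assumes x: "x \<in> carrier R" and m: "\<And>e. e \<in> Ob G \<Longrightarrow> m e = \<zero>\<^bsub>A e\<^esub>" and c: "c \<in> Ob G"
  shows "act x m c = \<zero>\<^bsub>A c\<^esub>"
proof -
  interpret C: ring "A c"
    by (rule ring_A[OF c])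
  have "x s \<otimes>\<^bsub>A c\<^esub> \<sigma> s (m (Dom G s)) = \<zero>\<^bsub>A c\<^esub>" if "s \<in> Mor G" "Cod G s = c" for s
    using that coeff_closed[OF x that(1)] by (simp add: m Dom_in_Ob sigma_zero)
  then have "act x m c = finsum (A c) (\<lambda>s. \<zero>\<^bsub>A c\<^esub>) {s \<in> supp x. Cod G s = c}"
    unfolding act_def by (intro C.finsum_cong') (use supp_Mor in auto)
  then show ?thesis
    by simp
qed

lemma act_add:
  assumes x: "x \<in> carrier R" and y: "y \<in> carrier R" and m: "m \<in> base_families" and c: "c \<in> Ob G"
  shows "act (x \<oplus>\<^bsub>R\<^esub> y) m c = act x m c \<oplus>\<^bsub>A c\<^esub> act y m c"
proof -
  interpret C: ring "A c"
    by (rule ring_A[OF c])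
  let ?F = "supp x \<union> supp y"
  let ?Q = "{s \<in> ?F. Cod G s = c}"
  have F: "finite ?F" "supp x \<subseteq> ?F" "supp y \<subseteq> ?F" "supp (x \<oplus>\<^bsub>R\<^esub> y) \<subseteq> ?F" "?F \<subseteq> Mor G"
    using x y finite_supp supp_add supp_Mor by auto
  let ?f = "\<lambda>w s. w s \<otimes>\<^bsub>A c\<^esub> \<sigma> s (m (Dom G s))"
  have f: "?f w \<in> ?Q \<rightarrow> carrier (A c)" if "w \<in> carrier R" for w
    using act_term_closed(2)[OF that m] F(5) by blast
  have "act (x \<oplus>\<^bsub>R\<^esub> y) m c = finsum (A c) (?f (x \<oplus>\<^bsub>R\<^esub> y)) ?Q"
    by (rule act_of_superset[OF add_closed[OF x y] m c F(1,4,5)])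
  also have "\<dots> = finsum (A c) (\<lambda>s. ?f x s \<oplus>\<^bsub>A c\<^esub> ?f y s) ?Q"
  proof (rule C.finsum_cong'[OF refl])
    fix s assume "s \<in> ?Q"
    then have s: "s \<in> Mor G" "Cod G s = c"
      using F(5) by auto
    show "?f (x \<oplus>\<^bsub>R\<^esub> y) s = ?f x s \<oplus>\<^bsub>A c\<^esub> ?f y s"
      using s x y coeff_closed[of _ s] act_term_closed(1)[OF x m s(1)] by (simp add: add_coeff C.l_distr)
  qed (intro Pi_I C.a_closed; use f[OF x] f[OF y] in blast)
  also have "\<dots> = finsum (A c) (?f x) ?Q \<oplus>\<^bsub>A c\<^esub> finsum (A c) (?f y) ?Q"
    by (rule C.finsum_addf[OF f[OF x] f[OF y]])
  also have "\<dots> = act x m c \<oplus>\<^bsub>A c\<^esub> act y m c"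
    by (simp only: act_of_superset[OF x m c F(1,2,5)] act_of_superset[OF y m c F(1,3,5)])
  finally show ?thesis .
qed

lemma act_add_right:
  assumes x: "x \<in> carrier R" and m: "m \<in> base_families" and n: "n \<in> base_families"
    and k: "\<And>e. e \<in> Ob G \<Longrightarrow> k e = m e \<oplus>\<^bsub>A e\<^esub> n e" and c: "c \<in> Ob G"
  shows "act x k c = act x m c \<oplus>\<^bsub>A c\<^esub> act x n c"
proof -
  interpret C: ring "A c"
    by (rule ring_A[OF c])
  let ?Q = "{s \<in> supp x. Cod G s = c}"
  let ?f = "\<lambda>m s. x s \<otimes>\<^bsub>A c\<^esub> \<sigma> s (m (Dom G s))"
  have f: "?f w \<in> ?Q \<rightarrow> carrier (A c)" if "w \<in> base_families" for w
    using act_term_closed(2)[OF x that] supp_Mor by blast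
  have "finsum (A c) (?f k) ?Q = finsum (A c) (\<lambda>s. ?f m s \<oplus>\<^bsub>A c\<^esub> ?f n s) ?Q"
  proof (rule C.finsum_cong'[OF refl])
    fix s assume "s \<in> ?Q"
    then have s: "s \<in> Mor G" "Cod G s = c"
      using supp_Mor by auto
    have "m (Dom G s) \<in> carrier (A (Dom G s))" "n (Dom G s) \<in> carrier (A (Dom G s))"
      using m n Dom_in_Ob[OF s(1)] by auto
    then have "\<sigma> s (k (Dom G s)) = \<sigma> s (m (Dom G s)) \<oplus>\<^bsub>A c\<^esub> \<sigma> s (n (Dom G s))"
      using s by (simp add: k Dom_in_Ob ring_hom_add[OF sigma_hom])
    then show "?f k s = ?f m s \<oplus>\<^bsub>A c\<^esub> ?f n s"
      using s coeff_closed[OF x s(1)] act_term_closed(1)[OF x m s(1)] act_term_closed(1)[OF x n s(1)]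
      by (simp add: C.r_distr)
  qed (intro Pi_I C.a_closed; use f[OF m] f[OF n] in blast)
  then show ?thesis
    unfolding act_def C.finsum_addf[OF f[OF m] f[OF n], symmetric] .
qed

lemma act_monomial:
  assumes s: "s \<in> Mor G" and a: "a \<in> carrier (A (Cod G s))" and m: "m \<in> base_families"
    and c: "c \<in> Ob G"
  shows "act (monomial G A a s) m c =
    (if c = Cod G s then a \<otimes>\<^bsub>A c\<^esub> \<sigma> s (m (Dom G s)) else \<zero>\<^bsub>A c\<^esub>)"
proof -
  interpret C: ring "A c"
    by (rule ring_A[OF c])
  have supp: "supp (monomial G A a s) \<subseteq> {s}"
    by (auto simp: skew_support_def monomial_def)
  have *: "act (monomial G A a s) m c = finsum (A c) (\<lambda>r. monomial G A a s r \<otimes>\<^bsub>A c\<^esub> \<sigma> r (m (Dom G r)))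
      {r \<in> {s}. Cod G r = c}"
    by (rule act_of_superset[OF monomial_closed[OF s a] m c _ supp]) (use s in auto)
  show ?thesis
  proof (cases "c = Cod G s")
    case True
    then have Q: "{r \<in> {s}. Cod G r = c} = {s}"
      by auto
    interpret D: ring "A (Cod G s)"
      by (rule ring_Cod[OF s])
    show ?thesis
      unfolding * Q
      using True s a act_term_closed(1)[OF monomial_closed[OF s a] m s]
      by (simp add: D.finsum_insert[of "{}"] monomial_def)
  next
    case False
    then have Q: "{r \<in> {s}. Cod G r = c} = {}"
      by auto
    show ?thesis
      unfolding * Q using False by simp
  qed
qed

text \<open>
If \<open>s\<close> and \<open>t\<close> are composable, both sides equal \<open>a \<sigma>\<^sub>s(b) \<sigma>\<^sub>s(\<sigma>\<^sub>t(m))\<close>. Otherwise the product is zero,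
and \<open>a u\<^sub>s\<close> only sees the component at \<open>Dom G s\<close>, where \<open>(b u\<^sub>t) \<cdot> m\<close> vanishes.
\<close>

lemma act_mult_monomial:
  assumes s: "s \<in> Mor G" and a: "a \<in> carrier (A (Cod G s))"
    and t: "t \<in> Mor G" and b: "b \<in> carrier (A (Cod G t))"
    and m: "m \<in> base_families" and c: "c \<in> Ob G"
  shows "act (monomial G A a s \<otimes>\<^bsub>R\<^esub> monomial G A b t) m c =
    act (monomial G A a s) (act (monomial G A b t) m) c"
proof -
  interpret C: ring "A (Cod G s)"
    by (rule ring_Cod[OF s])
  note n = act_closed[OF monomial_closed[OF t b] m]
  note rhs = act_monomial[OF s a n c] act_monomial[OF t b m Dom_in_Ob[OF s]]
  show ?thesis
  proof (cases "Dom G s = Cod G t")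
    case True
    then have st: "(s, t) \<in> composable G"
      using s t by (simp add: composable_def)
    have mor: "s \<diamondop> t \<in> Mor G" "Cod G (s \<diamondop> t) = Cod G s" "Dom G (s \<diamondop> t) = Dom G t"
      using s t True by (simp_all add: Cmp_closed Cod_Cmp Dom_Cmp)
    have mt: "m (Dom G t) \<in> carrier (A (Dom G t))"
      using m Dom_in_Ob[OF t] by auto
    have \<sigma>: "\<sigma> t (m (Dom G t)) \<in> carrier (A (Dom G s))" "\<sigma> s b \<in> carrier (A (Cod G s))"
        "\<sigma> s (\<sigma> t (m (Dom G t))) \<in> carrier (A (Cod G s))"
      using s t mt b True sigma_closed by metis+
    have "\<sigma> s (b \<otimes>\<^bsub>A (Cod G t)\<^esub> \<sigma> t (m (Dom G t))) =
        \<sigma> s b \<otimes>\<^bsub>A (Cod G s)\<^esub> \<sigma> s (\<sigma> t (m (Dom G t)))"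
      using ring_hom_mult[OF sigma_hom[OF s]] b \<sigma> True by simp
    then show ?thesis
      using rhs True s t a b st mor \<sigma> m c sigma_Cmp[OF st mt] term_closed[OF st a b]
      by (simp add: monomial_mult act_monomial C.m_assoc)
  next
    case False
    then have "(s, t) \<notin> composable G"
      by (simp add: composable_def)
    then show ?thesis
      using rhs False s t a b c by (simp add: monomial_mult act_zero sigma_zero)
  qed
qed

lemma act_mult:
  assumes x: "x \<in> carrier R" and y: "y \<in> carrier R" and m: "m \<in> base_families" and c: "c \<in> Ob G"
  shows "act (x \<otimes>\<^bsub>R\<^esub> y) m c = act x (act y m) c"
  using x
proof (induction x rule: skew_algebra_induct)
  case (monomial s a)
  note x = monomial_closed[OF monomial]
  show ?case
    using y
  proof (induction y rule: skew_algebra_induct)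
    case (monomial t b)
    then show ?case
      using \<open>s \<in> Mor G\<close> \<open>a \<in> carrier _\<close> m c by (simp add: act_mult_monomial)
  next
    case zero
    show ?case
      using act_zero_right[OF x _ c, of "act \<zero>\<^bsub>R\<^esub> m"] x c by (simp add: mult_zero act_zero)
  next
    case (add y z)
    then have "act (monomial G A a s) (act (y \<oplus>\<^bsub>R\<^esub> z) m) c =
        act (monomial G A a s) (act y m) c \<oplus>\<^bsub>A c\<^esub> act (monomial G A a s) (act z m) c"
      by (intro act_add_right[OF x act_closed act_closed _ c]) (auto simp: m act_add)
    then show ?case
      using add x m c by (simp add: mult_distrib act_add mult_closed)
  qed
next
  case zero
  then show ?case
    using y c by (simp add: mult_zero act_zero)
next
  case (add x z)
  then show ?case
    using y m c by (simp add: mult_distrib act_add mult_closed act_closed)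
qed

definition annihilator :: "('m \<Rightarrow> 'a) set" where
  "annihilator = {x \<in> carrier R. \<forall>m \<in> base_families. \<forall>c \<in> Ob G. act x m c = \<zero>\<^bsub>A c\<^esub>}"

lemma ideal_annihilator:
  assumes "finite (Ob G)"
  shows "ideal annihilator R"
proof -
  interpret ring R
    by (rule ring_R[OF assms])
  show ?thesis
  proof (rule idealI[OF ring_axioms])
    show "subgroup annihilator (add_monoid R)"
    proof (rule add.subgroupI)
      show "annihilator \<subseteq> carrier R"
        by (auto simp: annihilator_def)
      show "annihilator \<noteq> {}"
        using act_zero zero_closed by (auto simp: annihilator_def)
    next
      fix x assume x: "x \<in> annihilator"
      then have xR: "x \<in> carrier R"
        by (simp add: annihilator_def)
      have "act (\<ominus>\<^bsub>R\<^esub> x) m c = \<zero>\<^bsub>A c\<^esub>" if m: "m \<in> base_families" and c: "c \<in> Ob G" for m c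
      proof -
        interpret C: ring "A c"
          by (rule ring_A[OF c])
        have "act (\<ominus>\<^bsub>R\<^esub> x) m c \<in> carrier (A c)"
          using act_closed[OF a_inv_closed[OF xR] m] c by auto
        moreover have "act (\<ominus>\<^bsub>R\<^esub> x \<oplus>\<^bsub>R\<^esub> x) m c = act (\<ominus>\<^bsub>R\<^esub> x) m c \<oplus>\<^bsub>A c\<^esub> act x m c"
          using xR m c by (simp add: act_add)
        ultimately show ?thesis
          using x m c xR by (simp add: annihilator_def l_neg act_zero)
      qed
      then show "\<ominus>\<^bsub>R\<^esub> x \<in> annihilator"
        using xR by (simp add: annihilator_def)
    next
      fix x y assume "x \<in> annihilator" "y \<in> annihilator"
      then show "x \<oplus>\<^bsub>R\<^esub> y \<in> annihilator"
        by (auto simp: annihilator_def act_add ring.ring_simprules(2,8) ring_A)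
    qed
  next
    fix x y assume "x \<in> annihilator" "y \<in> carrier R"
    then show "y \<otimes>\<^bsub>R\<^esub> x \<in> annihilator" "x \<otimes>\<^bsub>R\<^esub> y \<in> annihilator"
      by (auto simp: annihilator_def act_mult act_closed act_zero_right simp del: Pi_iff)
  qed
qed

text \<open>
An element of the base ring maps the family of the ring identities to its own coefficients, so it
is zero if it annihilates everything.
\<close>

lemma annihilator_Int_base_ring:
  "annihilator \<inter> base_ring G A \<sigma> = {\<zero>\<^bsub>R\<^esub>}"
proof -
  have "x = \<zero>\<^bsub>R\<^esub>" if x: "x \<in> annihilator" "x \<in> base_ring G A \<sigma>" for x
  proof (rule skew_eqI)
    show xR: "x \<in> carrier R"
      using base_ringD x by blast
    fix r assume r: "r \<in> Mor G"
    show "x r = \<zero>\<^bsub>R\<^esub> r"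
    proof (cases "r \<in> Ob G")
      case True
      interpret C: ring "A r"
        by (rule ring_A[OF True])
      have ones: "(\<lambda>e. \<one>\<^bsub>A e\<^esub>) \<in> base_families"
        by (simp add: ring_A ring.ring_simprules(6))
      have F: "finite (insert r (supp x))" "supp x \<subseteq> insert r (supp x)" "insert r (supp x) \<subseteq> Mor G"
        using xR r supp_Mor by (auto simp: finite_supp)
      have Q: "{s \<in> insert r (supp x). Cod G s = r} = {r}"
        using True Cod_Ob base_ringD(2)[OF x(2)] by auto
      have "act x (\<lambda>e. \<one>\<^bsub>A e\<^esub>) r = x r"
        unfolding act_of_superset[OF xR ones True F] Q
        using True xR coeff_closed[OF xR r]
        by (simp add: C.finsum_insert[of "{}"] Dom_Ob Cod_Ob sigma_id)
      then show ?thesis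
        using x(1) ones True r by (auto simp: annihilator_def zero_coeff Cod_Ob simp del: Pi_iff)
    next
      case False
      then show ?thesis
        using x base_ringD(2) not_supp[OF r, of x] zero_coeff[OF r] by auto
    qed
  qed (rule zero_closed)
  moreover have "\<zero>\<^bsub>R\<^esub> \<in> annihilator \<inter> base_ring G A \<sigma>"
    using supp_empty_iff[OF zero_closed] zero_closed act_zero
    by (auto simp: annihilator_def base_ring_def)
  ultimately show ?thesis
    by blast
qed

text \<open>
Commuting with \<open>b u\<^sub>e\<close>, compared at \<open>s\<close>, says that \<open>x s\<close> times \<open>\<sigma>\<^sub>s(b)\<close>, present only for \<open>e = Dom G s\<close>,
equals \<open>b\<close> times \<open>x s\<close>, present only for \<open>e = Cod G s\<close>. Taking \<open>b = 1\<close> at the domain forces the two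
objects to agree.
\<close>

lemma commutant_coeff:
  assumes comm: "\<And>e. e \<in> Ob G \<Longrightarrow> cring (A e)"
    and x: "x \<in> commutant R (base_ring G A \<sigma>)" and s: "s \<in> supp x"
  shows "Dom G s = Cod G s"
    and "b \<in> carrier (A (Cod G s)) \<Longrightarrow> x s \<otimes>\<^bsub>A (Cod G s)\<^esub> \<sigma> s b = x s \<otimes>\<^bsub>A (Cod G s)\<^esub> b"
proof -
  have xR: "x \<in> carrier R"
    using x by (simp add: commutant_def)
  have m: "s \<in> Mor G" and xs: "x s \<noteq> \<zero>\<^bsub>A (Cod G s)\<^esub>"
    using s by (auto simp: skew_support_def)
  interpret C: cring "A (Cod G s)"
    by (rule comm[OF Cod_in_Ob[OF m]])
  have eq: "x s \<otimes>\<^bsub>A (Cod G s)\<^esub> \<sigma> s (monomial G A b e (Dom G s)) =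
      monomial G A b e (Cod G s) \<otimes>\<^bsub>A (Cod G s)\<^esub> x s"
    if e: "e \<in> Ob G" and b: "b \<in> carrier (A e)" for e b
  proof -
    have "monomial G A b e \<in> base_ring G A \<sigma>"
      using monomial_closed[of e b] e b
      by (auto simp: base_ring_def Ob_Mor Cod_Ob skew_support_def monomial_def)
    then show ?thesis
      using x xR m mult_base_left[of "monomial G A b e" x s] mult_base_right[of x "monomial G A b e" s]
      by (simp add: commutant_def)
  qed
  show DC: "Dom G s = Cod G s"
  proof (rule ccontr)
    assume ne: "Dom G s \<noteq> Cod G s"
    have "x s = x s \<otimes>\<^bsub>A (Cod G s)\<^esub> \<sigma> s (monomial G A \<one>\<^bsub>A (Dom G s)\<^esub> (Dom G s) (Dom G s))"
      using m coeff_closed[OF xR m] by (simp add: monomial_def Dom_closed sigma_one)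
    also have "\<dots> = \<zero>\<^bsub>A (Cod G s)\<^esub>"
      using eq[of "Dom G s" "\<one>\<^bsub>A (Dom G s)\<^esub>"] m ne coeff_closed[OF xR m]
      by (simp add: monomial_def Dom_in_Ob Cod_closed Cod_Cod ring_Dom ring.ring_simprules(6))
    finally show False
      using xs by simp
  qed
  show "x s \<otimes>\<^bsub>A (Cod G s)\<^esub> \<sigma> s b = x s \<otimes>\<^bsub>A (Cod G s)\<^esub> b" if b: "b \<in> carrier (A (Cod G s))"
    using eq[of "Cod G s" b] b m DC coeff_closed[OF xR m] C.m_comm[of "x s" b]
    by (simp add: monomial_def Cod_in_Ob Cod_closed)
qed

text \<open>
A coefficient \<open>a\<close> of a commuting element at a morphism \<open>s\<close> that is not an identity would make
\<open>a u\<^sub>e - a u\<^sub>s\<close>, with \<open>e = Cod G s\<close>, a nonzero element annihilating every family.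
\<close>

lemma commutant_subset_base_ring:
  assumes comm: "\<And>e. e \<in> Ob G \<Longrightarrow> cring (A e)"
    and faithful: "annihilator = {\<zero>\<^bsub>R\<^esub>}"
  shows "commutant R (base_ring G A \<sigma>) \<subseteq> base_ring G A \<sigma>"
proof
  fix x assume x: "x \<in> commutant R (base_ring G A \<sigma>)"
  then have xR: "x \<in> carrier R"
    by (simp add: commutant_def)
  have "s \<in> Ob G" if s: "s \<in> supp x" for s
  proof (rule ccontr)
    assume nOb: "s \<notin> Ob G"
    have m: "s \<in> Mor G" and xs: "x s \<noteq> \<zero>\<^bsub>A (Cod G s)\<^esub>"
      using s by (auto simp: skew_support_def)
    have DC: "Dom G s = Cod G s"
      by (rule commutant_coeff(1)[OF comm x s])
    have central: "x s \<otimes>\<^bsub>A (Cod G s)\<^esub> \<sigma> s b = x s \<otimes>\<^bsub>A (Cod G s)\<^esub> b"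
      if "b \<in> carrier (A (Cod G s))" for b
      by (intro commutant_coeff(2)[OF comm x s] that)
    let ?e = "Cod G s"
    have e: "?e \<in> Ob G" "?e \<in> Mor G" "?e \<noteq> s"
      using nOb Cod_in_Ob[OF m] Cod_closed[OF m] by auto
    interpret C: cring "A ?e"
      by (rule comm[OF e(1)])
    have a: "x s \<in> carrier (A ?e)"
      by (rule coeff_closed[OF xR m])
    define v where "v = monomial G A (x s) ?e \<oplus>\<^bsub>R\<^esub> monomial G A (\<ominus>\<^bsub>A ?e\<^esub> x s) s"
    have parts: "monomial G A (x s) ?e \<in> carrier R" "monomial G A (\<ominus>\<^bsub>A ?e\<^esub> x s) s \<in> carrier R"
      using monomial_closed a m e by (simp_all add: Cod_Cod)
    have "act v w c = \<zero>\<^bsub>A c\<^esub>" if w: "w \<in> base_families" and c: "c \<in> Ob G" for w c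
    proof -
      interpret D: ring "A c"
        by (rule ring_A[OF c])
      have we: "w ?e \<in> carrier (A ?e)"
        using w e by auto
      then have \<sigma>we: "\<sigma> s (w ?e) \<in> carrier (A ?e)"
        using sigma_closed[OF m] DC by simp
      have "act v w c = act (monomial G A (x s) ?e) w c \<oplus>\<^bsub>A c\<^esub> act (monomial G A (\<ominus>\<^bsub>A ?e\<^esub> x s) s) w c"
        unfolding v_def by (rule act_add[OF parts w c])
      also have "\<dots> = \<zero>\<^bsub>A c\<^esub>"
        using a m e w c we \<sigma>we central[OF we] DC
        by (simp add: act_monomial Cod_Cod Dom_Ob sigma_id C.l_minus C.r_neg)
      finally show ?thesis .
    qed
    then have "v \<in> annihilator"
      using add_closed[OF parts] by (simp add: annihilator_def v_def)
    then have "v s = \<zero>\<^bsub>A ?e\<^esub>"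
      using faithful zero_coeff[OF m] by simp
    then have "\<ominus>\<^bsub>A ?e\<^esub> x s = \<zero>\<^bsub>A ?e\<^esub>"
      using m e a by (simp add: v_def add_coeff monomial_def)
    then show False
      using xs a C.minus_minus C.minus_zero by metis
  qed
  then show "x \<in> base_ring G A \<sigma>"
    using xR by (auto simp: base_ring_def)
qed

end

section \<open>Maximal commutativity and ideal intersections\<close>

theorem theorem4:
  fixes G :: "'m cat"
    and A :: "'m \<Rightarrow> ('a, 'b) ring_scheme"
    and \<sigma> :: "'m \<Rightarrow> 'a \<Rightarrow> 'a"
  assumes "groupoid G"
    and "finite (Ob G)"
    and "skew_system G A \<sigma>"
    and "\<And>e. e \<in> Ob G \<Longrightarrow> cring (A e)"
  shows "maximal_commutative (base_ring G A \<sigma>) (skew_algebra G A \<sigma>) \<longleftrightarrow>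
    (\<forall>I. ideal I (skew_algebra G A \<sigma>) \<and> I \<noteq> {\<zero>\<^bsub>skew_algebra G A \<sigma>\<^esub>} \<longrightarrow>
      I \<inter> base_ring G A \<sigma> \<noteq> {\<zero>\<^bsub>skew_algebra G A \<sigma>\<^esub>})"
proof -
  interpret skew_system G A \<sigma>
    by (rule assms(3))
  have sub: "subcring (base_ring G A \<sigma>) R"
    by (rule base_ring_subcring[OF assms(2,4)])
  then have "base_ring G A \<sigma> \<subseteq> commutant R (base_ring G A \<sigma>)"
    using subcringE(1,8)[OF sub] by (auto simp: commutant_def)
  then have maximal_iff: "maximal_commutative (base_ring G A \<sigma>) R \<longleftrightarrow>
      commutant R (base_ring G A \<sigma>) \<subseteq> base_ring G A \<sigma>"
    using sub by (auto simp: maximal_commutative_def)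
  show ?thesis
    unfolding maximal_iff
    using ideal_meets_base_ring[OF assms(1,4)]
      commutant_subset_base_ring[OF assms(4)]
      ideal_annihilator[OF assms(2)] annihilator_Int_base_ring
    by blast
qed

end
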